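(* The logics $\mathsf L(\mathfrak Y_2)$, $\mathsf L(\mathfrak Y_2+)$, $\mathsf L(\mathfrak Y_3)$ and $\mathsf L(\mathfrak Y_3+)$ have nullary unification.
   Context: A frame is a finite poset with a least element; $\mathsf L(\mathfrak F)$ is the set of intuitionistic formulas valid in all Kripke models over $\mathfrak F$. $\mathfrak Y_2$: elements $r,a,b,t,s$ with $r<a$, $r<b$, $a<t$, $b<t$, $b<s$ (and transitivity), $t,s$ maximal, no other relations. $\mathfrak Y_3$: elements $r,a,b,c,d$ with $r<a$, $r<b$, and each of $a,b$ below each of $c,d$ (and transitivity), $c,d$ maximal, no other relations. $\mathfrak F+$ denotes $\mathfrak F$ with a new top element added above all elements. Unification in a logic $\mathsf L$ is nullary if some $\mathsf L$-unifiable formula has no minimal (w.r.t. inclusion) complete set of unifiers, where a set $\Sigma$ of unifiers of $A$ is complete if every unifier $\mu$ of $A$ satisfies $\alpha\circ\varepsilon=_{\mathsf L}\mu$ for some $\varepsilon\in\Sigma$ and substitution $\alpha$. *)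

theory Defs
  imports Main
begin

section \<open>Intuitionistic formulas and substitutions\<close>

datatype (vars: 'v) fm =
    Var 'v
  | Bot
  | And "'v fm" "'v fm"
  | Or "'v fm" "'v fm"
  | Imp "'v fm" "'v fm"

type_synonym formula = "nat fm"
type_synonym substitution = "nat \<Rightarrow> formula"

abbreviation Iff :: "'v fm \<Rightarrow> 'v fm \<Rightarrow> 'v fm" where
  "Iff A B \<equiv> And (Imp A B) (Imp B A)"

primrec subst :: "substitution \<Rightarrow> formula \<Rightarrow> formula" where
  "subst \<sigma> (Var x) = \<sigma> x"
| "subst \<sigma> Bot = Bot"
| "subst \<sigma> (And A B) = And (subst \<sigma> A) (subst \<sigma> B)"
| "subst \<sigma> (Or A B) = Or (subst \<sigma> A) (subst \<sigma> B)"
| "subst \<sigma> (Imp A B) = Imp (subst \<sigma> A) (subst \<sigma> B)"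

definition subst_comp :: "substitution \<Rightarrow> substitution \<Rightarrow> substitution" where
  "subst_comp \<alpha> \<epsilon> = (\<lambda>x. subst \<alpha> (\<epsilon> x))"

lemma subst_subst_comp: "subst (subst_comp \<alpha> \<epsilon>) A = subst \<alpha> (subst \<epsilon> A)"
  by (induction A) (simp_all add: subst_comp_def)


section \<open>Frames and their logics\<close>

text \<open>An ordered set is given by its reflexive order relation \<open>r\<close>; the carrier is \<open>Field r\<close>.\<close>

definition frame :: "'w rel \<Rightarrow> bool" where
  "frame r \<longleftrightarrow> finite (Field r) \<and> Partial_order r
     \<and> (\<exists>z\<in>Field r. \<forall>w\<in>Field r. (z, w) \<in> r)"

primrec forces :: "'w rel \<Rightarrow> ('v \<Rightarrow> 'w set) \<Rightarrow> 'w \<Rightarrow> 'v fm \<Rightarrow> bool" where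
  "forces r V w (Var x) \<longleftrightarrow> w \<in> V x"
| "forces r V w Bot \<longleftrightarrow> False"
| "forces r V w (And A B) \<longleftrightarrow> forces r V w A \<and> forces r V w B"
| "forces r V w (Or A B) \<longleftrightarrow> forces r V w A \<or> forces r V w B"
| "forces r V w (Imp A B) \<longleftrightarrow> (\<forall>v. (w, v) \<in> r \<longrightarrow> forces r V v A \<longrightarrow> forces r V v B)"

definition persistent :: "'w rel \<Rightarrow> ('v \<Rightarrow> 'w set) \<Rightarrow> bool" where
  "persistent r V \<longleftrightarrow> (\<forall>x. V x \<subseteq> Field r \<and> (\<forall>w v. w \<in> V x \<longrightarrow> (w, v) \<in> r \<longrightarrow> v \<in> V x))"

definition Logic :: "'w rel \<Rightarrow> formula set" where
  "Logic r = {A. \<forall>V. persistent r V \<longrightarrow> (\<forall>w\<in>Field r. forces r V w A)}"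


section \<open>Unification\<close>

definition unifier :: "formula set \<Rightarrow> formula \<Rightarrow> substitution \<Rightarrow> bool" where
  "unifier L A \<sigma> \<longleftrightarrow> subst \<sigma> A \<in> L"

definition unifiable :: "formula set \<Rightarrow> formula \<Rightarrow> bool" where
  "unifiable L A \<longleftrightarrow> (\<exists>\<sigma>. unifier L A \<sigma>)"

definition subst_eq_on :: "nat set \<Rightarrow> formula set \<Rightarrow> substitution \<Rightarrow> substitution \<Rightarrow> bool" where
  "subst_eq_on X L \<sigma> \<tau> \<longleftrightarrow> (\<forall>x\<in>X. Iff (\<sigma> x) (\<tau> x) \<in> L)"

text \<open>Unifiers of a formula \<open>A\<close> are compared on the variables of \<open>A\<close>: a substitution is
  mathematically a finite mapping, and only the values of a unifier of \<open>A\<close> on \<open>vars A\<close> matter.\<close>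

definition complete_unifiers :: "formula set \<Rightarrow> formula \<Rightarrow> substitution set \<Rightarrow> bool" where
  "complete_unifiers L A \<Sigma> \<longleftrightarrow>
     (\<forall>\<epsilon>\<in>\<Sigma>. unifier L A \<epsilon>) \<and>
     (\<forall>\<mu>. unifier L A \<mu> \<longrightarrow> (\<exists>\<epsilon>\<in>\<Sigma>. \<exists>\<alpha>. subst_eq_on (vars A) L (subst_comp \<alpha> \<epsilon>) \<mu>))"

definition minimal_complete_unifiers :: "formula set \<Rightarrow> formula \<Rightarrow> substitution set \<Rightarrow> bool" where
  "minimal_complete_unifiers L A \<Sigma> \<longleftrightarrow>
     complete_unifiers L A \<Sigma> \<and> (\<forall>\<Sigma>'. \<Sigma>' \<subset> \<Sigma> \<longrightarrow> \<not> complete_unifiers L A \<Sigma>')"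

definition nullary_unification :: "formula set \<Rightarrow> bool" where
  "nullary_unification L \<longleftrightarrow>
     (\<exists>A. unifiable L A \<and> \<not> (\<exists>\<Sigma>. minimal_complete_unifiers L A \<Sigma>))"


section \<open>The frames\<close>

datatype y2 = R2 | A2 | B2 | T2 | S2

definition Y2 :: "y2 rel" where
  "Y2 = {(R2, A2), (R2, B2), (A2, T2), (B2, T2), (B2, S2)}\<^sup>*"

datatype y3 = R3 | A3 | B3 | C3 | D3

definition Y3 :: "y3 rel" where
  "Y3 = {(R3, A3), (R3, B3), (A3, C3), (A3, D3), (B3, C3), (B3, D3)}\<^sup>*"

text \<open>The new top element is \<open>None\<close>.\<close>

definition add_top :: "'w rel \<Rightarrow> 'w option rel" where
  "add_top r = {(Some x, Some y) |x y. (x, y) \<in> r}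
     \<union> {(w, None) |w. w \<in> insert None (Some ` Field r)}"

lemma Field_add_top: "Field (add_top r) = insert None (Some ` Field r)"
proof (rule set_eqI)
  fix u
  have "(u, None) \<in> add_top r" if "u \<in> insert None (Some ` Field r)"
    using that by (simp add: add_top_def)
  moreover have "u \<in> insert None (Some ` Field r)" if "(u, v) \<in> add_top r \<or> (v, u) \<in> add_top r" for v
    using that by (auto simp: add_top_def intro: FieldI1 FieldI2)
  ultimately show "u \<in> Field (add_top r) \<longleftrightarrow> u \<in> insert None (Some ` Field r)"
    unfolding Field_def by blast
qed

lemma frame_add_top:
  assumes "frame r"
  shows "frame (add_top r)"
proof -
  from assms obtain z where z: "z \<in> Field r" "\<And>w. w \<in> Field r \<Longrightarrow> (z, w) \<in> r"
    and fin: "finite (Field r)" and po: "Partial_order r"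
    unfolding frame_def by blast
  from po have "refl_on (Field r) r" "trans r" "antisym r"
    by (auto simp: order_on_defs)
  have [simp]: "(Some x, Some y) \<in> add_top r \<longleftrightarrow> (x, y) \<in> r" "(None, Some y) \<notin> add_top r"
    "(u, None) \<in> add_top r \<longleftrightarrow> u \<in> insert None (Some ` Field r)" for x y u
    by (auto simp: add_top_def)
  have "refl_on (Field (add_top r)) (add_top r)"
    using \<open>refl_on (Field r) r\<close> unfolding Field_add_top refl_on_def by auto
  moreover have "antisym (add_top r)"
  proof (rule antisymI)
    fix u v assume "(u, v) \<in> add_top r" "(v, u) \<in> add_top r"
    then show "u = v"
      using \<open>antisym r\<close> by (cases u; cases v) (auto dest: antisymD)
  qed
  moreover have "trans (add_top r)"
  proof (rule transI)
    fix u v w assume uv: "(u, v) \<in> add_top r" and vw: "(v, w) \<in> add_top r"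
    have "u \<in> insert None (Some ` Field r)"
      using FieldI1[OF uv] unfolding Field_add_top .
    with uv vw show "(u, w) \<in> add_top r"
      using \<open>trans r\<close> by (cases u; cases v; cases w) (auto dest: transD)
  qed
  moreover have "add_top r \<subseteq> Field (add_top r) \<times> Field (add_top r)"
    by (auto intro: FieldI1 FieldI2)
  ultimately have "Partial_order (add_top r)"
    unfolding order_on_defs by blast
  moreover have "\<forall>w\<in>Field (add_top r). (Some z, w) \<in> add_top r"
    using z unfolding Field_add_top by (auto simp: add_top_def)
  ultimately show ?thesis
    using fin z(1) unfolding frame_def by (auto simp: Field_add_top)
qed

lemma Y2_iff: "(x, y) \<in> Y2 \<longleftrightarrow>
  x = y \<or> x = R2 \<or> (x, y) \<in> {(A2, T2), (B2, T2), (B2, S2)}"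
proof
  assume "(x, y) \<in> Y2"
  then show "x = y \<or> x = R2 \<or> (x, y) \<in> {(A2, T2), (B2, T2), (B2, S2)}"
    unfolding Y2_def by (induction rule: rtrancl_induct) auto
next
  let ?E = "{(R2, A2), (R2, B2), (A2, T2), (B2, T2), (B2, S2)}"
  have e: "(R2, A2) \<in> ?E\<^sup>*" "(R2, B2) \<in> ?E\<^sup>*" "(A2, T2) \<in> ?E\<^sup>*" "(B2, T2) \<in> ?E\<^sup>*" "(B2, S2) \<in> ?E\<^sup>*"
    by (rule r_into_rtrancl, simp)+
  have "(R2, T2) \<in> ?E\<^sup>*" "(R2, S2) \<in> ?E\<^sup>*"
    using e rtrancl_trans by metis+
  moreover assume "x = y \<or> x = R2 \<or> (x, y) \<in> {(A2, T2), (B2, T2), (B2, S2)}"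
  ultimately show "(x, y) \<in> Y2"
    unfolding Y2_def using e by (cases y) auto
qed

lemma Y3_iff: "(x, y) \<in> Y3 \<longleftrightarrow>
  x = y \<or> x = R3 \<or> (x, y) \<in> {A3, B3} \<times> {C3, D3}"
proof
  assume "(x, y) \<in> Y3"
  then show "x = y \<or> x = R3 \<or> (x, y) \<in> {A3, B3} \<times> {C3, D3}"
    unfolding Y3_def by (induction rule: rtrancl_induct) auto
next
  let ?E = "{(R3, A3), (R3, B3), (A3, C3), (A3, D3), (B3, C3), (B3, D3)}"
  have e: "(R3, A3) \<in> ?E\<^sup>*" "(R3, B3) \<in> ?E\<^sup>*" "(A3, C3) \<in> ?E\<^sup>*" "(A3, D3) \<in> ?E\<^sup>*"
    "(B3, C3) \<in> ?E\<^sup>*" "(B3, D3) \<in> ?E\<^sup>*"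
    by (rule r_into_rtrancl, simp)+
  have "(R3, C3) \<in> ?E\<^sup>*" "(R3, D3) \<in> ?E\<^sup>*"
    using e rtrancl_trans by metis+
  moreover assume "x = y \<or> x = R3 \<or> (x, y) \<in> {A3, B3} \<times> {C3, D3}"
  ultimately show "(x, y) \<in> Y3"
    unfolding Y3_def using e by (cases y) auto
qed

lemma Field_Y2: "Field Y2 = UNIV"
  by (auto simp: Y2_iff Field_def)

lemma Field_Y3: "Field Y3 = UNIV"
  by (auto simp: Y3_iff Field_def)

lemma frame_Y2: "frame Y2"
proof -
  have "(UNIV :: y2 set) = {R2, A2, B2, T2, S2}"
    using y2.exhaust by blast
  then have "finite (UNIV :: y2 set)"
    by (metis finite.emptyI finite.insertI)
  moreover have "antisym Y2"
    by (rule antisymI) (auto simp: Y2_iff)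
  moreover have "refl Y2" "trans Y2"
    unfolding Y2_def by (rule refl_rtrancl, rule trans_rtrancl)
  moreover have "(R2, w) \<in> Y2" for w
    by (simp add: Y2_iff)
  ultimately show ?thesis
    unfolding frame_def order_on_defs Field_Y2 by auto
qed

lemma frame_Y3: "frame Y3"
proof -
  have "(UNIV :: y3 set) = {R3, A3, B3, C3, D3}"
    using y3.exhaust by blast
  then have "finite (UNIV :: y3 set)"
    by (metis finite.emptyI finite.insertI)
  moreover have "antisym Y3"
    by (rule antisymI) (auto simp: Y3_iff)
  moreover have "refl Y3" "trans Y3"
    unfolding Y3_def by (rule refl_rtrancl, rule trans_rtrancl)
  moreover have "(R3, w) \<in> Y3" for w
    by (simp add: Y3_iff)
  ultimately show ?thesis
    unfolding frame_def order_on_defs Field_Y3 by auto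
qed

end

theory Submission
  imports Defs
begin

text \<open>
  Consider \<open>A = (x \<or> y) \<and> \<not>\<not>x \<and> \<not>\<not>y\<close>. A minimal complete set of unifiers would
  consist of maximally general unifiers, but every unifier \<open>\<epsilon>\<close> of \<open>A\<close> can be improved strictly.
  With a fresh variable \<open>s\<close>, let \<open>\<delta> x = (s \<rightarrow> \<epsilon> x) \<and> (\<not>s \<rightarrow> G)\<close> and
  \<open>\<delta> y = (s \<rightarrow> \<epsilon> y) \<and> (\<not>s \<rightarrow> H)\<close>; the substitution \<open>s := \<top>\<close> recovers \<open>\<epsilon>\<close>. Two maximal points
  (below the added top, if there is one) are labelled by subsets \<open>I\<close> and \<open>J\<close> of a set of
  more variables than \<open>\<epsilon>\<close> has, and \<open>G\<close>, \<open>H\<close> are chosen such that for \<open>I \<noteq> J\<close> a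
  point seeing both can refute \<open>G\<close> or \<open>H\<close> in a way that is impossible if \<open>I = J\<close>. If \<open>\<delta>\<close> were an
  instance of \<open>\<epsilon>\<close>, the pigeonhole principle would give \<open>I \<noteq> J\<close> that \<open>\<epsilon>\<close> cannot
  distinguish; then a point refuting \<open>\<epsilon> x\<close> and a point refuting \<open>\<epsilon> y\<close> can be put side by side below the
  same maximal points, and the root refutes \<open>\<epsilon> x \<or> \<epsilon> y\<close>.
\<close>

abbreviation Neg :: "'v fm \<Rightarrow> 'v fm" where
  "Neg A \<equiv> Imp A Bot"

section \<open>Kripke semantics\<close>

lemma frame_refl: "frame r \<Longrightarrow> w \<in> Field r \<Longrightarrow> (w, w) \<in> r"
  by (auto simp: frame_def order_on_defs refl_on_def)

lemma frame_trans: "frame r \<Longrightarrow> (u, v) \<in> r \<Longrightarrow> (v, w) \<in> r \<Longrightarrow> (u, w) \<in> r"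
  by (auto simp: frame_def order_on_defs dest: transD)

lemma persistentD: "persistent r V \<Longrightarrow> w \<in> V x \<Longrightarrow> (w, v) \<in> r \<Longrightarrow> v \<in> V x"
  unfolding persistent_def by blast

lemma forces_mono:
  assumes "frame r" "persistent r V" "forces r V w A" "(w, v) \<in> r"
  shows "forces r V v A"
  using assms(3,4)
proof (induction A)
  case (Var x)
  then show ?case using assms(2) by (auto simp: persistent_def)
next
  case (Imp A B)
  then show ?case using frame_trans[OF assms(1)] by (metis forces.simps(5))
qed auto

lemma not_forces_ImpE:
  assumes "\<not> forces r V w (Imp A B)"
  obtains v where "(w, v) \<in> r" "forces r V v A" "\<not> forces r V v B"
  using assms by auto

lemma forces_ImpI: "frame r \<Longrightarrow> persistent r V \<Longrightarrow> forces r V w B \<Longrightarrow> forces r V w (Imp A B)"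
  using forces_mono by (metis forces.simps(5))

lemma forces_Logic:
  assumes "A \<in> Logic r" "persistent r V" "w \<in> Field r"
  shows "forces r V w A"
  using assms by (auto simp: Logic_def)

text \<open>Induction on \<open>A\<close>; only the implication case uses the back and forth
  conditions. Agreement is asked on \<open>X\<close> alone, so that points differing in irrelevant
  variables can be identified.\<close>

lemma forces_bisim:
  assumes "\<And>w w' x. (w, w') \<in> R \<Longrightarrow> x \<in> X \<Longrightarrow> w \<in> V x \<longleftrightarrow> w' \<in> V' x"
    and "\<And>w w' v. (w, w') \<in> R \<Longrightarrow> (w, v) \<in> r \<Longrightarrow> \<exists>v'. (w', v') \<in> r' \<and> (v, v') \<in> R"
    and "\<And>w w' v'. (w, w') \<in> R \<Longrightarrow> (w', v') \<in> r' \<Longrightarrow> \<exists>v. (w, v) \<in> r \<and> (v, v') \<in> R"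
    and "vars A \<subseteq> X" "(w, w') \<in> R"
  shows "forces r V w A \<longleftrightarrow> forces r' V' w' A"
  using assms(4,5)
proof (induction A arbitrary: w w')
  case (Var x)
  then show ?case using assms(1) by simp
next
  case (Imp A B)
  then have A: "forces r V v A = forces r' V' v' A" and B: "forces r V v B = forces r' V' v' B"
    if "(v, v') \<in> R" for v v'
    using that by auto
  show ?case
  proof
    assume l: "forces r V w (Imp A B)"
    show "forces r' V' w' (Imp A B)"
      unfolding forces.simps using l A B assms(3)[OF Imp.prems(2)] by (metis forces.simps(5))
  next
    assume l: "forces r' V' w' (Imp A B)"
    show "forces r V w (Imp A B)"
      unfolding forces.simps using l A B assms(2)[OF Imp.prems(2)] by (metis forces.simps(5))
  qed
qed auto

lemma forces_cong:
  assumes fr: "frame r" and w: "w \<in> Field r"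
    and eq: "\<And>v x. (w, v) \<in> r \<Longrightarrow> x \<in> vars A \<Longrightarrow> v \<in> V x \<longleftrightarrow> v \<in> V' x"
  shows "forces r V w A \<longleftrightarrow> forces r V' w A"
proof (rule forces_bisim[where R = "{(v, v) |v. (w, v) \<in> r}" and X = "vars A"])
  show "(w, w) \<in> {(v, v) |v. (w, v) \<in> r}"
    using frame_refl[OF fr w] by simp
  show "\<exists>v'. (u', v') \<in> r \<and> (v, v') \<in> {(v, v) |v. (w, v) \<in> r}"
    if "(u, u') \<in> {(v, v) |v. (w, v) \<in> r}" "(u, v) \<in> r" for u u' v
    using that frame_trans[OF fr] by blast
  show "\<exists>v. (u, v) \<in> r \<and> (v, v') \<in> {(v, v) |v. (w, v) \<in> r}"
    if "(u, u') \<in> {(v, v) |v. (w, v) \<in> r}" "(u', v') \<in> r" for u u' v'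
    using that frame_trans[OF fr] by blast
qed (use eq in auto)

text \<open>Restricted to \<open>Field r\<close> to keep the valuation persistent: outside the
  carrier every implication holds vacuously.\<close>

definition subst_val :: "'w rel \<Rightarrow> (nat \<Rightarrow> 'w set) \<Rightarrow> substitution \<Rightarrow> nat \<Rightarrow> 'w set" where
  "subst_val r V \<sigma> = (\<lambda>x. {w \<in> Field r. forces r V w (\<sigma> x)})"

lemma forces_subst:
  "w \<in> Field r \<Longrightarrow> forces r V w (subst \<sigma> A) \<longleftrightarrow> forces r (subst_val r V \<sigma>) w A"
proof (induction A arbitrary: w)
  case (Imp A B)
  then show ?case by (auto intro: FieldI2)
qed (auto simp: subst_val_def)

lemma persistent_subst_val:
  assumes "frame r" "persistent r V"
  shows "persistent r (subst_val r V \<sigma>)"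
  using forces_mono[OF assms] by (auto simp: persistent_def subst_val_def intro: FieldI2)

lemma Logic_subst:
  assumes "frame r" "A \<in> Logic r"
  shows "subst \<sigma> A \<in> Logic r"
  using assms persistent_subst_val by (auto simp: Logic_def forces_subst)

lemma Iff_Logic:
  assumes "frame r"
  shows "Iff A B \<in> Logic r \<longleftrightarrow>
    (\<forall>V. persistent r V \<longrightarrow> (\<forall>w\<in>Field r. forces r V w A \<longleftrightarrow> forces r V w B))"
  using frame_refl[OF assms] by (fastforce simp: Logic_def intro: FieldI2)

lemma subst_eq_on_trans:
  assumes "frame r" "subst_eq_on X (Logic r) \<sigma> \<tau>" "subst_eq_on X (Logic r) \<tau> \<upsilon>"
  shows "subst_eq_on X (Logic r) \<sigma> \<upsilon>"
  using assms(2,3) unfolding subst_eq_on_def Iff_Logic[OF assms(1)] by blast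

lemma subst_eq_on_comp:
  assumes "frame r" "subst_eq_on X (Logic r) \<sigma> \<tau>"
  shows "subst_eq_on X (Logic r) (subst_comp \<alpha> \<sigma>) (subst_comp \<alpha> \<tau>)"
  using assms(2) Logic_subst[OF assms(1)] unfolding subst_eq_on_def subst_comp_def
  by (metis subst.simps(3,5))

lemma subst_comp_assoc:
  "subst_comp \<alpha> (subst_comp \<beta> \<sigma>) = subst_comp (subst_comp \<alpha> \<beta>) \<sigma>"
proof
  fix x show "subst_comp \<alpha> (subst_comp \<beta> \<sigma>) x = subst_comp (subst_comp \<alpha> \<beta>) \<sigma> x"
    using subst_subst_comp[of \<alpha> \<beta> "\<sigma> x"] by (simp add: subst_comp_def)
qed

lemma factor_trans:
  assumes "frame r" "subst_eq_on X (Logic r) (subst_comp \<alpha> \<sigma>) \<tau>"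
    "subst_eq_on X (Logic r) (subst_comp \<beta> \<tau>) \<upsilon>"
  shows "\<exists>\<gamma>. subst_eq_on X (Logic r) (subst_comp \<gamma> \<sigma>) \<upsilon>"
  using subst_eq_on_trans[OF assms(1) subst_eq_on_comp[OF assms(1,2)] assms(3)]
  unfolding subst_comp_assoc by blast

section \<open>A sufficient condition for nullary unification\<close>

text \<open>Some member \<open>\<eta>\<close> of a complete set has the improvement
  \<open>\<delta>\<close> of its member \<open>\<epsilon>\<close> as an instance, and
  \<open>\<eta>\<close> differs from \<open>\<epsilon>\<close>, which does not. Whatever is an
  instance of \<open>\<epsilon>\<close> is then one of \<open>\<eta>\<close>, through
  \<open>\<delta>\<close>, so \<open>\<epsilon>\<close> can be removed and no complete set is
  minimal.\<close>

lemma nullary_unificationI: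
  assumes fr: "frame r" and un: "unifiable (Logic r) A"
    and improve: "\<And>\<epsilon>. unifier (Logic r) A \<epsilon> \<Longrightarrow> \<exists>\<delta> \<gamma>. unifier (Logic r) A \<delta> \<and>
      subst_eq_on (vars A) (Logic r) (subst_comp \<gamma> \<delta>) \<epsilon> \<and>
      (\<forall>\<beta>. \<not> subst_eq_on (vars A) (Logic r) (subst_comp \<beta> \<epsilon>) \<delta>)"
  shows "nullary_unification (Logic r)"
proof -
  have False if "minimal_complete_unifiers (Logic r) A \<Sigma>" for \<Sigma>
  proof -
    have co: "complete_unifiers (Logic r) A \<Sigma>"
      and mi: "\<And>\<Sigma>'. \<Sigma>' \<subset> \<Sigma> \<Longrightarrow> \<not> complete_unifiers (Logic r) A \<Sigma>'"
      using that by (auto simp: minimal_complete_unifiers_def)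
    obtain \<epsilon> where \<epsilon>: "\<epsilon> \<in> \<Sigma>"
      using un co by (auto simp: unifiable_def complete_unifiers_def)
    then obtain \<delta> \<gamma> where \<delta>: "unifier (Logic r) A \<delta>"
      and \<gamma>: "subst_eq_on (vars A) (Logic r) (subst_comp \<gamma> \<delta>) \<epsilon>"
      and nf: "\<And>\<beta>. \<not> subst_eq_on (vars A) (Logic r) (subst_comp \<beta> \<epsilon>) \<delta>"
      using improve co by (meson complete_unifiers_def)
    obtain \<eta> \<beta> where \<eta>: "\<eta> \<in> \<Sigma>" "subst_eq_on (vars A) (Logic r) (subst_comp \<beta> \<eta>) \<delta>"
      using co \<delta> by (meson complete_unifiers_def)
    then have ne: "\<eta> \<noteq> \<epsilon>"
      using nf by blast
    have "complete_unifiers (Logic r) A (\<Sigma> - {\<epsilon>})"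
      unfolding complete_unifiers_def
    proof (intro conjI allI impI)
      show "\<forall>\<epsilon>\<in>\<Sigma> - {\<epsilon>}. unifier (Logic r) A \<epsilon>"
        using co by (simp add: complete_unifiers_def)
    next
      fix \<mu> assume "unifier (Logic r) A \<mu>"
      then obtain \<zeta> \<alpha> where \<zeta>: "\<zeta> \<in> \<Sigma>" "subst_eq_on (vars A) (Logic r) (subst_comp \<alpha> \<zeta>) \<mu>"
        using co by (meson complete_unifiers_def)
      show "\<exists>\<epsilon>\<in>\<Sigma> - {\<epsilon>}. \<exists>\<alpha>. subst_eq_on (vars A) (Logic r) (subst_comp \<alpha> \<epsilon>) \<mu>"
      proof (cases "\<zeta> = \<epsilon>")
        case True
        then show ?thesis
          using factor_trans[OF fr \<eta>(2)] \<gamma> \<zeta>(2) factor_trans[OF fr] \<eta>(1) ne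
          by (metis DiffI singletonD)
      next
        case False
        then show ?thesis using \<zeta> by blast
      qed
    qed
    then show False using mi[of "\<Sigma> - {\<epsilon>}"] \<epsilon> by blast
  qed
  then show ?thesis using un by (auto simp: nullary_unification_def)
qed

section \<open>The formula and the improvement of a unifier\<close>

definition witness :: formula where
  "witness = And (Or (Var 0) (Var 1)) (And (Neg (Neg (Var 0))) (Neg (Neg (Var 1))))"

text \<open>At a single point a double negation speaks about all points above it; demanded at every
  point, it only says that each point sees one that forces the formula.\<close>

lemma unifier_witness_iff:
  assumes "frame r"
  shows "unifier (Logic r) witness \<epsilon> \<longleftrightarrow> (\<forall>V. persistent r V \<longrightarrow> (\<forall>w\<in>Field r.
    (forces r V w (\<epsilon> 0) \<or> forces r V w (\<epsilon> 1)) \<and>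
    (\<exists>v. (w, v) \<in> r \<and> forces r V v (\<epsilon> 0)) \<and> (\<exists>v. (w, v) \<in> r \<and> forces r V v (\<epsilon> 1))))"
proof -
  have nn: "(\<forall>w\<in>Field r. forces r V w (Neg (Neg A))) \<longleftrightarrow> (\<forall>w\<in>Field r. \<exists>v. (w, v) \<in> r \<and> forces r V v A)"
    for V and A :: formula
    using frame_refl[OF assms] by (fastforce intro: FieldI2)
  show ?thesis
    using nn[of _ "\<epsilon> 0"] nn[of _ "\<epsilon> 1"]
    by (simp add: unifier_def witness_def Logic_def ball_conj_distrib del: forces.simps(5))
qed

lemma unifiable_witness:
  assumes "frame r"
  shows "unifiable (Logic r) witness"
proof -
  have "unifier (Logic r) witness (\<lambda>_. Imp Bot Bot)"
    using frame_refl[OF assms] by (auto simp: unifier_witness_iff[OF assms])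
  then show ?thesis by (auto simp: unifiable_def)
qed

text \<open>Only the values at 0 and 1 matter, these being the variables of \<open>witness\<close>;
  all others share the value at 1.\<close>

definition extend :: "nat \<Rightarrow> formula \<Rightarrow> formula \<Rightarrow> substitution \<Rightarrow> substitution" where
  "extend s G H \<epsilon> = (\<lambda>x. if x = 0 then And (Imp (Var s) (\<epsilon> 0)) (Imp (Neg (Var s)) G)
     else And (Imp (Var s) (\<epsilon> 1)) (Imp (Neg (Var s)) H))"

text \<open>If one of the two clauses guarded by \<open>Neg (Var s)\<close> fails at
  \<open>w\<close>, then \<open>w\<close> forces \<open>Neg (Var s)\<close>, the clauses guarded by
  \<open>s\<close> are vacuous there, and \<open>GH\<close> supplies the other disjunct. If neither
  fails, the disjunction for \<open>\<epsilon>\<close> decides. \<open>GHd\<close> yields the double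
  negations.\<close>

lemma unifier_extend:
  fixes r :: "'a rel"
  assumes fr: "frame r" and un: "unifier (Logic r) witness \<epsilon>"
    and GH: "\<And>V w. persistent r V \<Longrightarrow> w \<in> Field r \<Longrightarrow>
      forces r V w (Imp (Neg (Var s)) G) \<or> forces r V w (Imp (Neg (Var s)) H)"
    and G: "\<And>V w. persistent r V \<Longrightarrow> w \<in> Field r \<Longrightarrow>
      forces r V w (Imp (Neg (Var s)) G) \<or> forces r V w (Neg (Var s))"
    and H: "\<And>V w. persistent r V \<Longrightarrow> w \<in> Field r \<Longrightarrow>
      forces r V w (Imp (Neg (Var s)) H) \<or> forces r V w (Neg (Var s))"
    and GHd: "\<And>V w. persistent r V \<Longrightarrow> w \<in> Field r \<Longrightarrow>
      \<exists>v. (w, v) \<in> r \<and> forces r V v G \<and> forces r V v H"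
  shows "unifier (Logic r) witness (extend s G H \<epsilon>)"
  unfolding unifier_witness_iff[OF fr]
proof (intro allI impI ballI conjI)
  fix V :: "nat \<Rightarrow> 'a set" and w assume V: "persistent r V" and w: "w \<in> Field r"
  note mono = forces_mono[OF fr V]
  have u: "forces r V w (\<epsilon> 0) \<or> forces r V w (\<epsilon> 1)"
    and u0: "\<And>w. w \<in> Field r \<Longrightarrow> \<exists>v. (w, v) \<in> r \<and> forces r V v (\<epsilon> 0)"
    and u1: "\<And>w. w \<in> Field r \<Longrightarrow> \<exists>v. (w, v) \<in> r \<and> forces r V v (\<epsilon> 1)"
    using un V w by (auto simp: unifier_witness_iff[OF fr])
  have K: "forces r V w (Imp B A)" if "forces r V w A" for w and A B :: formula
    using that mono by auto
  have Kn: "forces r V w (Imp A B)" if "forces r V w (Neg A)" for w and A B :: formula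
    using that by auto
  show "forces r V w (extend s G H \<epsilon> 0) \<or> forces r V w (extend s G H \<epsilon> 1)"
    using GH[OF V w] G[OF V w] H[OF V w] u K Kn
    by (auto simp: extend_def simp del: forces.simps(5))
  obtain v where v: "(w, v) \<in> r" "forces r V v G" "forces r V v H"
    using GHd[OF V w] by blast
  obtain v0 where v0: "(v, v0) \<in> r" "forces r V v0 (\<epsilon> 0)"
    using u0 v(1) by (meson FieldI2)
  obtain v1 where v1: "(v, v1) \<in> r" "forces r V v1 (\<epsilon> 1)"
    using u1 v(1) by (meson FieldI2)
  have "forces r V v0 (extend s G H \<epsilon> 0)"
    using v v0 mono[of v] K by (simp add: extend_def del: forces.simps(5))
  then show "\<exists>v. (w, v) \<in> r \<and> forces r V v (extend s G H \<epsilon> 0)"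
    using v(1) v0(1) frame_trans[OF fr] by blast
  have "forces r V v1 (extend s G H \<epsilon> 1)"
    using v v1 mono[of v] K by (simp add: extend_def del: forces.simps(5))
  then show "\<exists>v. (w, v) \<in> r \<and> forces r V v (extend s G H \<epsilon> 1)"
    using v(1) v1(1) frame_trans[OF fr] by blast
qed

lemma subst_fresh: "s \<notin> vars A \<Longrightarrow> subst (Var(s := B)) A = A"
  by (induction A) auto

text \<open>Once \<open>s\<close> is true, the second conjunct is vacuous whatever \<open>G\<close>
  and \<open>H\<close> are; freshness of \<open>s\<close> keeps \<open>\<epsilon>\<close> itself
  unchanged.\<close>

lemma extend_more_general:
  assumes "frame r" "s \<notin> vars (\<epsilon> 0) \<union> vars (\<epsilon> 1)"
  shows "subst_eq_on (vars witness) (Logic r)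
    (subst_comp (Var(s := Imp Bot Bot)) (extend s G H \<epsilon>)) \<epsilon>"
proof -
  have "forces r V w (subst (Var(s := Imp Bot Bot)) (extend s G H \<epsilon> x)) \<longleftrightarrow> forces r V w (\<epsilon> x)"
    if "x \<in> {0, 1}" "persistent r V" "w \<in> Field r" for V w x
  proof -
    have "(v, v) \<in> r" if "(w, v) \<in> r" for v
      using that frame_refl[OF assms(1)] by (blast intro: FieldI2)
    then show ?thesis
      using that assms(2) frame_refl[OF assms(1)] forces_mono[OF assms(1)]
      by (auto simp: extend_def subst_fresh) blast+
  qed
  moreover have "vars witness = {0, 1}"
    by (auto simp: witness_def)
  ultimately show ?thesis
    by (auto simp: subst_eq_on_def Iff_Logic[OF assms(1)] subst_comp_def)
qed

text \<open>\<open>E0\<close> and \<open>E1\<close> stand for the values of a unifier at 0 and 1.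
  The last clause of \<open>step\<close> says that no \<open>\<beta>\<close> turns them into the
  values of the extension.\<close>

lemma nullary_witness:
  assumes fr: "frame r"
    and step: "\<And>E0 E1. Or E0 E1 \<in> Logic r \<Longrightarrow> \<exists>s G H. s \<notin> vars E0 \<union> vars E1 \<and>
      (\<forall>\<epsilon>. unifier (Logic r) witness \<epsilon> \<longrightarrow> unifier (Logic r) witness (extend s G H \<epsilon>)) \<and>
      (\<forall>\<beta>. \<exists>V w. persistent r V \<and> w \<in> Field r \<and>
         (forces r V w (subst \<beta> E0) \<noteq> forces r V w (And (Imp (Var s) E0) (Imp (Neg (Var s)) G)) \<or>
          forces r V w (subst \<beta> E1) \<noteq> forces r V w (And (Imp (Var s) E1) (Imp (Neg (Var s)) H))))"
  shows "nullary_unification (Logic r)"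
proof (rule nullary_unificationI[OF fr unifiable_witness[OF fr]])
  fix \<epsilon> assume un: "unifier (Logic r) witness \<epsilon>"
  then have "Or (\<epsilon> 0) (\<epsilon> 1) \<in> Logic r"
    unfolding unifier_witness_iff[OF fr] by (auto simp: Logic_def)
  from step[OF this] obtain s G H where s: "s \<notin> vars (\<epsilon> 0) \<union> vars (\<epsilon> 1)"
    and ex: "unifier (Logic r) witness (extend s G H \<epsilon>)"
    and no: "\<And>\<beta>. \<exists>V w. persistent r V \<and> w \<in> Field r \<and>
         (forces r V w (subst \<beta> (\<epsilon> 0)) \<noteq> forces r V w (extend s G H \<epsilon> 0) \<or>
          forces r V w (subst \<beta> (\<epsilon> 1)) \<noteq> forces r V w (extend s G H \<epsilon> 1))"
    using un by (auto simp: extend_def simp del: forces.simps)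
  have "\<not> subst_eq_on (vars witness) (Logic r) (subst_comp \<beta> \<epsilon>) (extend s G H \<epsilon>)" for \<beta>
    using no[of \<beta>]
    by (auto simp: subst_eq_on_def Iff_Logic[OF fr] subst_comp_def witness_def simp del: forces.simps)
  with ex extend_more_general[OF fr s]
  show "\<exists>\<delta> \<gamma>. unifier (Logic r) witness \<delta> \<and>
      subst_eq_on (vars witness) (Logic r) (subst_comp \<gamma> \<delta>) \<epsilon> \<and>
      (\<forall>\<beta>. \<not> subst_eq_on (vars witness) (Logic r) (subst_comp \<beta> \<epsilon>) \<delta>)"
    by blast
qed

section \<open>Agreement of the coordinates\<close>

text \<open>This is weak excluded middle for \<open>z\<close>, with \<open>q\<close> in the role of falsity: when \<open>q\<close> holds only
  at the added top element, the formula speaks about the frame without that element.\<close>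

definition split :: "nat \<Rightarrow> nat \<Rightarrow> formula" where
  "split q z = Or (Imp (Var z) (Var q)) (Imp (Imp (Var z) (Var q)) (Var q))"

definition agree :: "nat \<Rightarrow> nat list \<Rightarrow> formula" where
  "agree q zs = foldr (\<lambda>z. And (split q z)) zs (Neg Bot)"

lemma forces_agree: "forces r V w (agree q zs) \<longleftrightarrow> (\<forall>z\<in>set zs. forces r V w (split q z))"
  unfolding agree_def by (induction zs) auto

lemma not_agreeE:
  assumes "\<not> forces r V w (agree q zs)"
  obtains z e e' where "(w, e) \<in> r" "(w, e') \<in> r" "z \<in> set zs" "e \<in> V z" "e \<notin> V q" "e' \<notin> V q"
    "\<And>v. (e', v) \<in> r \<Longrightarrow> v \<in> V z \<Longrightarrow> v \<in> V q"
  using assms unfolding forces_agree split_def by auto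

definition linear_above :: "'w rel \<Rightarrow> 'w \<Rightarrow> bool" where
  "linear_above r w \<longleftrightarrow> (\<forall>u v. (w, u) \<in> r \<longrightarrow> (w, v) \<in> r \<longrightarrow> (u, v) \<in> r \<or> (v, u) \<in> r)"

definition maximal_in :: "'w rel \<Rightarrow> 'w \<Rightarrow> bool" where
  "maximal_in r w \<longleftrightarrow> (\<forall>v. (w, v) \<in> r \<longrightarrow> v = w)"

text \<open>The witnesses \<open>e\<close> and \<open>e'\<close> of a failure are incomparable:
  \<open>e\<close> below \<open>e'\<close> would give \<open>z\<close>, hence \<open>q\<close>, at
  \<open>e'\<close>, and \<open>e'\<close> below \<open>e\<close> would give \<open>q\<close> at
  \<open>e\<close>.\<close>

lemma linear_above_agree:
  assumes fr: "frame r" and V: "persistent r V" and "linear_above r w"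
  shows "forces r V w (agree q zs)"
proof (rule ccontr)
  assume "\<not> forces r V w (agree q zs)"
  then obtain z e e' where e: "(w, e) \<in> r" "(w, e') \<in> r" "e \<in> V z" "e \<notin> V q" "e' \<notin> V q"
    "\<And>v. (e', v) \<in> r \<Longrightarrow> v \<in> V z \<Longrightarrow> v \<in> V q"
    by (rule not_agreeE) (rule that)
  then consider "(e, e') \<in> r" | "(e', e) \<in> r"
    using assms(3) by (auto simp: linear_above_def)
  then show False
  proof cases
    case 1
    then show ?thesis
      using e V frame_refl[OF fr FieldI2[OF 1]] by (auto simp: persistent_def)
  next
    case 2
    then show ?thesis using e by blast
  qed
qed

lemma maximal_linear: "frame r \<Longrightarrow> maximal_in r w \<Longrightarrow> linear_above r w"
  by (auto simp: linear_above_def maximal_in_def)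

text \<open>The restrictions of \<open>V\<close> to the points above \<open>a\<close> and of
  \<open>V'\<close> to the points above \<open>b\<close> agree on the overlap, so their union
  refutes both \<open>E0\<close> at \<open>a\<close> and \<open>E1\<close> at \<open>b\<close>. Then
  \<open>z\<close>, lying below both, would refute the disjunction.\<close>

lemma glue:
  assumes fr: "frame r" and E: "Or E0 E1 \<in> Logic r"
    and a: "(z, a) \<in> r" "\<not> forces r V a E0" "persistent r V"
    and b: "(z, b) \<in> r" "\<not> forces r V' b E1" "persistent r V'"
    and ab: "\<And>w x. (a, w) \<in> r \<Longrightarrow> (b, w) \<in> r \<Longrightarrow> x \<in> vars E0 \<union> vars E1 \<Longrightarrow> w \<in> V x \<longleftrightarrow> w \<in> V' x"
  shows False
proof -
  define U where "U x = (if x \<in> vars E0 \<union> vars E1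
    then {w \<in> V x. (a, w) \<in> r} \<union> {w \<in> V' x. (b, w) \<in> r} else {})" for x
  have U: "persistent r U"
    unfolding persistent_def
  proof (intro allI conjI impI)
    show "U x \<subseteq> Field r" for x
      by (auto simp: U_def intro: FieldI2)
    show "v \<in> U x" if "w \<in> U x" "(w, v) \<in> r" for x w v
    proof (cases "x \<in> vars E0 \<union> vars E1")
      case True
      then show ?thesis
        using that(1) frame_trans[OF fr _ that(2)] persistentD[OF a(3) _ that(2)]
          persistentD[OF b(3) _ that(2)]
        unfolding U_def by simp blast
    qed (use that(1) in \<open>simp add: U_def\<close>)
  qed
  have "forces r U a E0 \<longleftrightarrow> forces r V a E0"
    using ab by (intro forces_cong[OF fr FieldI2[OF a(1)]]) (auto simp: U_def)
  moreover have "forces r U b E1 \<longleftrightarrow> forces r V' b E1"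
    using ab by (intro forces_cong[OF fr FieldI2[OF b(1)]]) (auto simp: U_def)
  moreover have "forces r U z (Or E0 E1)"
    using forces_Logic[OF E U] a(1) by (blast intro: FieldI1)
  ultimately show False
    using a b forces_mono[OF fr U] by (metis forces.simps(4))
qed

text \<open>Write P for \<open>agree q zs\<close>. It fails only at points with a branching up-set,
  and these are comparable by \<open>cmp\<close>. A point with \<open>u\<close> but not P is never
  comparable to a point with u -> P but not P, so within one model u -> P or (u -> P) -> P holds
  throughout.\<close>

lemma unifier_extend_Y2:
  fixes r :: "'a rel"
  assumes fr: "frame r" and un: "unifier (Logic r) witness \<epsilon>"
    and cmp: "\<And>v w. v \<in> Field r \<Longrightarrow> w \<in> Field r \<Longrightarrow> \<not> linear_above r v \<Longrightarrow> \<not> linear_above r w \<Longrightarrow>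
      (v, w) \<in> r \<or> (w, v) \<in> r"
    and cub: "\<And>v w. v \<in> Field r \<Longrightarrow> w \<in> Field r \<Longrightarrow> \<not> linear_above r v \<Longrightarrow> \<exists>e. (v, e) \<in> r \<and> (w, e) \<in> r"
    and mx: "\<And>w. w \<in> Field r \<Longrightarrow> \<exists>v. (w, v) \<in> r \<and> maximal_in r v"
  shows "unifier (Logic r) witness (extend s
    (Imp (Imp (Var u) (agree q zs)) (agree q zs)) (Imp (Var u) (agree q zs)) \<epsilon>)"
proof (rule unifier_extend[OF fr un])
  let ?P = "agree q zs"
  fix V :: "nat \<Rightarrow> 'a set" and w assume V: "persistent r V" and w: "w \<in> Field r"
  note mono = forces_mono[OF fr V]
  \<comment> \<open>By \<open>cub\<close>, \<open>v\<close> has an upper bound in common with any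
    \<open>x\<close> above \<open>w\<close>. If \<open>s\<close> held at \<open>x\<close>, it would
    hold at that bound, against \<open>Neg (Var s)\<close> at \<open>v\<close>.\<close>
  have s: "forces r V w (Neg (Var s))" if "(w, v) \<in> r" "forces r V v (Neg (Var s))" "\<not> forces r V v ?P" for v
  proof -
    have "x \<notin> V s" if "(w, x) \<in> r" for x
      using cub[of v x] linear_above_agree[OF fr V, of v] that \<open>(w, v) \<in> r\<close> \<open>\<not> forces r V v ?P\<close>
        \<open>forces r V v (Neg (Var s))\<close> mono[of x "Var s"] by (auto dest: FieldI2)
    then show ?thesis by simp
  qed
  have s': "forces r V w (Imp (Neg (Var s)) (Imp A ?P)) \<or> forces r V w (Neg (Var s))" for A
    using s forces_ImpI[OF fr V] by (meson not_forces_ImpE)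
  show "forces r V w (Imp (Neg (Var s)) (Imp (Var u) ?P)) \<or> forces r V w (Neg (Var s))"
    "forces r V w (Imp (Neg (Var s)) (Imp (Imp (Var u) ?P) ?P)) \<or> forces r V w (Neg (Var s))"
    by (rule s')+
  have False
    if v: "v \<in> Field r" "forces r V v (Var u)" "\<not> forces r V v ?P"
      and v': "v' \<in> Field r" "forces r V v' (Imp (Var u) ?P)" "\<not> forces r V v' ?P" for v v'
  proof -
    have "\<not> linear_above r v" "\<not> linear_above r v'"
      using linear_above_agree[OF fr V] v(3) v'(3) by blast+
    then consider "(v, v') \<in> r" | "(v', v) \<in> r"
      using cmp v(1) v'(1) by blast
    then show False
    proof cases
      case 1
      then show ?thesis
        using mono[OF v(2) 1] v'(2,3) frame_refl[OF fr v'(1)] by auto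
    next
      case 2
      then show ?thesis
        using v(2,3) v'(2) by auto
    qed
  qed
  then show "forces r V w (Imp (Neg (Var s)) (Imp (Imp (Var u) ?P) ?P)) \<or>
    forces r V w (Imp (Neg (Var s)) (Imp (Var u) ?P))"
    by (meson not_forces_ImpE FieldI2)
  obtain v where v: "(w, v) \<in> r" "maximal_in r v"
    using mx[OF w] by blast
  then have "forces r V v ?P"
    using linear_above_agree[OF fr V] maximal_linear[OF fr] by blast
  then show "\<exists>v. (w, v) \<in> r \<and> forces r V v (Imp (Imp (Var u) ?P) ?P) \<and> forces r V v (Imp (Var u) ?P)"
    using v(1) forces_ImpI[OF fr V] by blast
qed

text \<open>A failure of the disjunction about \<open>u\<close> at \<open>v\<close> is a strict step
  from \<open>v\<close> to some \<open>x\<close> with \<open>u\<close> but not \<open>q\<close>; a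
  failure of \<open>agree q zs\<close> anywhere gives incomparable \<open>e\<close> and
  \<open>e'\<close>. By \<open>cmp\<close>, either \<open>v\<close> sees both and refutes
  \<open>agree q zs\<close> itself, or \<open>x\<close> is above both and gets \<open>z\<close>,
  hence \<open>q\<close>. So the two formulas do not both fail in one model.\<close>

lemma unifier_extend_Y3:
  fixes r :: "'a rel"
  assumes fr: "frame r" and un: "unifier (Logic r) witness \<epsilon>"
    and cmp: "\<And>v w e e'. (v, w) \<in> r \<Longrightarrow> v \<noteq> w \<Longrightarrow> e \<in> Field r \<Longrightarrow> e' \<in> Field r \<Longrightarrow>
      (e, e') \<notin> r \<Longrightarrow> (e', e) \<notin> r \<Longrightarrow> (v, e) \<in> r \<and> (v, e') \<in> r \<or> (e, w) \<in> r \<and> (e', w) \<in> r"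
    and cub: "\<And>v w. v \<in> Field r \<Longrightarrow> w \<in> Field r \<Longrightarrow> \<not> maximal_in r v \<Longrightarrow> \<exists>e. (v, e) \<in> r \<and> (w, e) \<in> r"
    and mx: "\<And>w. w \<in> Field r \<Longrightarrow> \<exists>v. (w, v) \<in> r \<and> maximal_in r v"
  shows "unifier (Logic r) witness (extend s
    (Imp (agree q zs) (Or (Var u) (Imp (Var u) (Var q)))) (agree q zs) \<epsilon>)"
proof (rule unifier_extend[OF fr un])
  let ?P = "agree q zs" and ?Q = "Or (Var u) (Imp (Var u) (Var q))"
  fix V :: "nat \<Rightarrow> 'a set" and w assume V: "persistent r V" and w: "w \<in> Field r"
  note mono = forces_mono[OF fr V]
  have Pm: "forces r V v ?P" if "maximal_in r v" for v
    using linear_above_agree[OF fr V] maximal_linear[OF fr that] by blast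
  have Qm: "forces r V v ?Q" if "maximal_in r v" for v
    using that by (auto simp: maximal_in_def)
  have s: "forces r V w (Neg (Var s))" if "(w, v) \<in> r" "forces r V v (Neg (Var s))" "\<not> maximal_in r v" for v
  proof -
    have "x \<notin> V s" if "(w, x) \<in> r" for x
      using cub[of v x] that \<open>(w, v) \<in> r\<close> \<open>\<not> maximal_in r v\<close>
        \<open>forces r V v (Neg (Var s))\<close> mono[of x "Var s"] by (auto dest: FieldI2)
    then show ?thesis by simp
  qed
  have not_maximal: "\<not> maximal_in r v" if "\<not> forces r V v (Imp ?P ?Q)" for v
    using Qm forces_ImpI[OF fr V] that by blast
  show "forces r V w (Imp (Neg (Var s)) ?P) \<or> forces r V w (Neg (Var s))"
    using s Pm by (meson not_forces_ImpE)
  show "forces r V w (Imp (Neg (Var s)) (Imp ?P ?Q)) \<or> forces r V w (Neg (Var s))"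
    using s not_maximal by (meson not_forces_ImpE)
  have "forces r V v' ?P" if v: "v \<in> Field r" "v' \<in> Field r" "forces r V v ?P" "\<not> forces r V v ?Q" for v v'
  proof (rule ccontr)
    assume "\<not> forces r V v' ?P"
    then obtain z e e' where e: "(v', e) \<in> r" "(v', e') \<in> r" "z \<in> set zs" "e \<in> V z" "e \<notin> V q"
      "e' \<notin> V q" "\<And>v. (e', v) \<in> r \<Longrightarrow> v \<in> V z \<Longrightarrow> v \<in> V q"
      by (rule not_agreeE) (rule that)
    have F: "e \<in> Field r" "e' \<in> Field r"
      using e(1,2) by (blast intro: FieldI2)+
    have up: "(w, v) \<in> r \<Longrightarrow> w \<in> V x \<Longrightarrow> v \<in> V x" for w v x
      using V by (auto simp: persistent_def)
    have "(e, e') \<notin> r" "(e', e) \<notin> r"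
      using e up frame_refl[OF fr F(2)] by blast+
    moreover obtain x where x: "(v, x) \<in> r" "x \<in> V u" "x \<notin> V q" "v \<notin> V u"
      using v(4) by auto
    ultimately consider "(v, e) \<in> r" "(v, e') \<in> r" | "(e, x) \<in> r" "(e', x) \<in> r"
      using cmp[of v x e e'] F by blast
    then show False
    proof cases
      case 1
      then have "\<not> forces r V v (split q z)"
        using e F by (auto simp: split_def)
      then show ?thesis
        using v(3) e(3) by (auto simp: forces_agree)
    next
      case 2
      then show ?thesis
        using e x up by blast
    qed
  qed
  then show "forces r V w (Imp (Neg (Var s)) (Imp ?P ?Q)) \<or> forces r V w (Imp (Neg (Var s)) ?P)"
    by (meson not_forces_ImpE FieldI2)
  obtain v where v: "(w, v) \<in> r" "maximal_in r v"
    using mx[OF w] by blast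
  then show "\<exists>v. (w, v) \<in> r \<and> forces r V v (Imp ?P ?Q) \<and> forces r V v ?P"
    using Pm Qm forces_ImpI[OF fr V] by blast
qed

section \<open>No factorization\<close>

locale clique =
  fixes r :: "'w rel" and M :: "'w set" and p p' :: 'w and s q u :: nat and zs :: "nat list"
  assumes frame: "frame r"
    and up: "r `` {p} = insert p M" "r `` {p'} = insert p' M"
    and new: "p \<notin> M" "p' \<notin> M" "p \<noteq> p'"
    and distinct: "distinct (s # q # u # zs)"
begin

text \<open>The set \<open>M\<close> is empty or consists of the added top element; \<open>p\<close> and \<open>p'\<close> carry the labels
  \<open>I\<close> and \<open>J\<close>.\<close>

definition val :: "nat set \<Rightarrow> nat set \<Rightarrow> 'w set \<Rightarrow> nat \<Rightarrow> 'w set" where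
  "val I J B x = (if x = s then {} else if x = q then M else if x = u then M \<union> {p, p'} \<union> B
     else M \<union> (if x \<in> I then {p} else {}) \<union> (if x \<in> J then {p'} else {}))"

lemma up_p: "(p, v) \<in> r \<longleftrightarrow> v = p \<or> v \<in> M"
  using up(1) by auto

lemma up_p': "(p', v) \<in> r \<longleftrightarrow> v = p' \<or> v \<in> M"
  using up(2) by auto

text \<open>A point above \<open>m\<close> is above both \<open>p\<close> and \<open>p'\<close>, and
  neither of these is above the other.\<close>

lemma up_M: "m \<in> M \<Longrightarrow> (m, v) \<in> r \<Longrightarrow> v \<in> M"
  using frame_trans[OF frame, of p m v] frame_trans[OF frame, of p' m v] new
  by (auto simp: up_p up_p')

lemma M_Field: "M \<subseteq> Field r" "p \<in> Field r" "p' \<in> Field r"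
  using up_p up_p' by (blast intro: FieldI1 FieldI2)+

lemma persistent_val:
  assumes "B \<subseteq> Field r" "\<And>v w. v \<in> B \<Longrightarrow> (v, w) \<in> r \<Longrightarrow> w \<in> B \<union> M \<union> {p, p'}"
  shows "persistent r (val I J B)"
  using assms M_Field up_M unfolding persistent_def val_def by (auto simp: up_p up_p' split: if_splits)

text \<open>On \<open>M\<close> every variable except \<open>s\<close> is true, whatever the
  labels.\<close>

lemma forces_val_M:
  assumes "m \<in> M"
  shows "forces r (val I J B) m A \<longleftrightarrow> forces r (val I' J' B') m A"
  by (rule forces_bisim[where R = "{(w, w) |w. w \<in> M}" and X = UNIV])
    (use assms up_M new in \<open>auto simp: val_def\<close>)

lemma forces_val_p: "forces r (val I J B) p A \<longleftrightarrow> forces r (val I J' B') p A"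
  by (rule forces_bisim[where R = "{(w, w) |w. w = p \<or> w \<in> M}" and X = UNIV])
    (use up_M new in \<open>auto simp: val_def up_p\<close>)

text \<open>Swapping \<open>p\<close> and \<open>p'\<close> is a bisimulation over \<open>M\<close>,
  so what a labelled point forces depends on its label alone.\<close>

lemma forces_val_p': "forces r (val J I B) p' A \<longleftrightarrow> forces r (val I J' B') p A"
  by (rule forces_bisim[where R = "insert (p', p) {(w, w) |w. w \<in> M}" and X = UNIV])
    (use up_M new in \<open>auto simp: val_def up_p up_p'\<close>)

text \<open>The colour of a label is the set of those \<open>k\<close> whose value
  \<open>\<beta> k\<close> is forced at a point carrying it. There are more labels than colours, so
  two distinct labels share one.\<close>

lemma exists_same_colour:
  assumes "finite K" "card K < length zs"
  obtains I J where "I \<subseteq> set zs" "J \<subseteq> set zs" "I \<noteq> J"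
    "\<And>k B B' I' J'. k \<in> K \<Longrightarrow> forces r (val I J' B) p (\<beta> k) \<longleftrightarrow> forces r (val I' J B') p' (\<beta> k)"
proof -
  define colour where "colour I = {k \<in> K. forces r (val I {} {}) p (\<beta> k)}" for I
  have "colour ` Pow (set zs) \<subseteq> Pow K"
    by (auto simp: colour_def)
  then have "card (colour ` Pow (set zs)) \<le> 2 ^ card K"
    using card_mono[of "Pow K"] assms(1) by (simp add: card_Pow)
  also have "\<dots> < 2 ^ length zs"
    using assms(2) by simp
  also have "\<dots> = card (Pow (set zs))"
    using distinct by (simp add: card_Pow distinct_card)
  finally have "\<not> inj_on colour (Pow (set zs))"
    by (rule pigeonhole)
  then obtain I J where IJ: "I \<subseteq> set zs" "J \<subseteq> set zs" "I \<noteq> J" "colour I = colour J"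
    by (auto simp: inj_on_def)
  have "forces r (val I J' B) p (\<beta> k) \<longleftrightarrow> forces r (val I' J B') p' (\<beta> k)" if "k \<in> K" for k B B' I' J'
    using IJ(4) that forces_val_p[of I J' B "\<beta> k" "{}" "{}"] forces_val_p'[of I' J B' "\<beta> k" "{}" "{}"]
    by (auto simp: colour_def)
  with IJ(1-3) show thesis
    by (rule that)
qed

lemma agree_val_M: "m \<in> M \<Longrightarrow> forces r (val I J B) m (agree q zs)"
  using up_M distinct by (auto simp: forces_agree split_def val_def)

lemma agree_val_p: "forces r (val I J B) p (agree q zs)" "forces r (val I J B) p' (agree q zs)"
  using new distinct by (auto simp: forces_agree split_def val_def up_p up_p')

text \<open>For a variable \<open>z\<close> in exactly one of \<open>I\<close> and \<open>J\<close>,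
  one of \<open>p\<close>, \<open>p'\<close> has \<open>z\<close> without \<open>q\<close>, and the
  other forces z -> q without \<open>q\<close>.\<close>

lemma not_agree_val:
  assumes "(w, p) \<in> r" "(w, p') \<in> r" "I \<subseteq> set zs" "J \<subseteq> set zs" "I \<noteq> J"
  shows "\<not> forces r (val I J B) w (agree q zs)"
proof -
  obtain z where z: "z \<in> set zs" "z \<in> I \<longleftrightarrow> z \<notin> J"
    using assms(3-5) by blast
  then have "\<not> forces r (val I J B) w (split q z)"
    using assms(1,2) new distinct up_M by (auto simp: split_def val_def up_p up_p')
  then show ?thesis using z(1) by (auto simp: forces_agree)
qed

text \<open>If \<open>\<beta>\<close> worked, distinct labels of one colour would let
  \<open>b\<close> refute \<open>E0\<close> under one valuation and \<open>E1\<close> under another.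
  The first refutation can be moved to \<open>a\<close>, which sees only one labelled point, and
  \<open>glue\<close> then gives a contradiction.\<close>

lemma no_factor_Y2:
  assumes E: "Or E0 E1 \<in> Logic r" and card: "card (vars E0 \<union> vars E1) < length zs"
    and a: "(z, a) \<in> r" "r `` {a} = {a, p} \<union> M"
    and b: "(z, b) \<in> r" "r `` {b} = {b, p, p'} \<union> M"
    and ab: "a \<notin> {b, p, p'} \<union> M" "b \<notin> {a, p, p'} \<union> M"
  shows "\<exists>V w. persistent r V \<and> w \<in> Field r \<and>
    (forces r V w (subst \<beta> E0) \<noteq> forces r V w (And (Imp (Var s) E0) (Imp (Neg (Var s))
       (Imp (Imp (Var u) (agree q zs)) (agree q zs)))) \<or>
     forces r V w (subst \<beta> E1) \<noteq> forces r V w (And (Imp (Var s) E1) (Imp (Neg (Var s))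
       (Imp (Var u) (agree q zs)))))"
proof (rule ccontr)
  let ?P = "agree q zs" and ?K = "vars E0 \<union> vars E1"
  assume "\<not> ?thesis"
  then have eq: "forces r V w (subst \<beta> E0) \<longleftrightarrow> forces r V w (And (Imp (Var s) E0) (Imp (Neg (Var s))
       (Imp (Imp (Var u) ?P) ?P)))"
    "forces r V w (subst \<beta> E1) \<longleftrightarrow> forces r V w (And (Imp (Var s) E1) (Imp (Neg (Var s)) (Imp (Var u) ?P)))"
    if "persistent r V" "w \<in> Field r" for V w
    using that by blast+
  have "finite ?K"
    by (simp add: fm.set_finite)
  then obtain I J where IJ: "I \<subseteq> set zs" "J \<subseteq> set zs" "I \<noteq> J"
    and col: "\<And>k B B' I' J'. k \<in> ?K \<Longrightarrow>
      forces r (val I J' B) p (\<beta> k) \<longleftrightarrow> forces r (val I' J B') p' (\<beta> k)"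
    by (rule exists_same_colour[OF _ card, where \<beta> = \<beta>]) (rule that)
  have upa: "(a, v) \<in> r \<longleftrightarrow> v \<in> {a, p} \<union> M" and upb: "(b, v) \<in> r \<longleftrightarrow> v \<in> {b, p, p'} \<union> M" for v
    using a(2) b(2) by auto
  have F: "a \<in> Field r" "b \<in> Field r"
    using a(1) b(1) by (blast intro: FieldI2)+
  \<comment> \<open>The underlying valuations differ only in \<open>u\<close> at \<open>b\<close>:
    false for \<open>V0\<close>, so that \<open>b\<close> will refute the extension at 0, and true
    for \<open>V1\<close>, so that \<open>b\<close> will refute it at 1.\<close>
  define V0 where "V0 = subst_val r (val I J {}) \<beta>"
  define V1 where "V1 = subst_val r (val I J {b}) \<beta>"
  have per: "persistent r (val I J {})" "persistent r (val I J {b})"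
    using F upb by (auto intro!: persistent_val)
  have s: "forces r (val I' J' B) w (Neg (Var s))" for I' J' B w
    by (simp add: val_def)
  have nP: "\<not> forces r (val I J B) b ?P" for B
    using not_agree_val[OF _ _ IJ] upb by blast
  \<comment> \<open>Above \<open>b\<close>, the variable \<open>u\<close> holds just at
    \<open>p\<close>, \<open>p'\<close> and \<open>M\<close>, and none of these points sees both
    labels.\<close>
  have "forces r (val I J {}) b (Imp (Var u) ?P)"
    unfolding forces.simps(5)
  proof (intro allI impI)
    fix v assume "(b, v) \<in> r" "forces r (val I J {}) v (Var u)"
    then have "v = p \<or> v = p' \<or> v \<in> M"
      using ab(2) distinct by (auto simp: val_def upb)
    then show "forces r (val I J {}) v ?P"
      using agree_val_p agree_val_M by blast
  qed
  then have "\<not> forces r (val I J {}) b (subst \<beta> E0)"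
    unfolding eq(1)[OF per(1) F(2)] using s nP frame_refl[OF frame F(2)]
    by (metis forces.simps(3,5))
  then have 0: "\<not> forces r V0 b E0"
    unfolding V0_def by (simp add: forces_subst F)
  have "forces r (val I J {b}) b (Var u)"
    using distinct by (simp add: val_def)
  then have "\<not> forces r (val I J {b}) b (subst \<beta> E1)"
    unfolding eq(2)[OF per(2) F(2)] using s nP frame_refl[OF frame F(2)]
    by (metis forces.simps(3,5))
  then have 1: "\<not> forces r V1 b E1"
    unfolding V1_def by (simp add: forces_subst F)
  have V0: "persistent r V0" and V1: "persistent r V1"
    unfolding V0_def V1_def using per by (auto intro: persistent_subst_val frame)
  have p_eq: "p \<in> V0 k \<longleftrightarrow> p \<in> V1 k" for k
    using forces_val_p M_Field by (auto simp: V0_def V1_def subst_val_def)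
  have M_eq: "m \<in> V0 k \<longleftrightarrow> m \<in> V1 k" if "m \<in> M" for k m
    using forces_val_M[OF that, of I J "{}" "\<beta> k" I J "{b}"] by (auto simp: V0_def V1_def subst_val_def)
  have p'_eq: "p' \<in> V0 k \<longleftrightarrow> p \<in> V0 k" if "k \<in> ?K" for k
    using col[OF that] M_Field by (auto simp: V0_def V1_def subst_val_def)
  \<comment> \<open>The variables of \<open>E0\<close> do not distinguish \<open>p\<close> from \<open>p'\<close>, so the fork at \<open>b\<close> can be copied to the chain at \<open>a\<close>.\<close>
  define V2 where "V2 k = (if b \<in> V0 k then {a} else {}) \<union> (V0 k \<inter> ({p} \<union> M))" for k
  have V2: "persistent r V2"
    unfolding persistent_def
  proof (intro allI conjI impI)
    show "V2 k \<subseteq> Field r" for k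
      using F M_Field by (auto simp: V2_def)
    show "w \<in> V2 k" if vw: "v \<in> V2 k" "(v, w) \<in> r" for k v w
    proof (cases "v = a")
      case True
      then have "b \<in> V0 k"
        using vw(1) ab by (auto simp: V2_def split: if_splits)
      then show ?thesis
        using persistentD[OF V0, of b k w] vw(2) True upa upb by (auto simp: V2_def)
    next
      case False
      then show ?thesis
        using persistentD[OF V0 _ vw(2), of k] vw up_p up_M by (auto simp: V2_def split: if_splits)
    qed
  qed
  have "forces r V2 a E0 \<longleftrightarrow> forces r V0 b E0"
  proof (rule forces_bisim[where R = "{(a, b), (p, p), (p, p')} \<union> {(m, m) |m. m \<in> M}" and X = "?K"])
    show "w \<in> V2 k \<longleftrightarrow> w' \<in> V0 k" if "(w, w') \<in> {(a, b), (p, p), (p, p')} \<union> {(m, m) |m. m \<in> M}" "k \<in> ?K" for w w' k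
      using that ab new p'_eq by (auto simp: V2_def)
  qed (use upa upb up_p up_p' up_M in auto)
  with 0 have 0: "\<not> forces r V2 a E0"
    by simp
  show False
  proof (rule glue[OF frame E a(1) 0 V2 b(1) 1 V1])
    \<comment> \<open>The up-sets meet only in \<open>p\<close> and \<open>M\<close>, from where the
      change of \<open>u\<close> at \<open>b\<close> is invisible.\<close>
    fix w k assume "(a, w) \<in> r" "(b, w) \<in> r"
    then have "w = p \<or> w \<in> M" "w \<noteq> a"
      using ab by (auto simp: upa upb)
    then show "w \<in> V2 k \<longleftrightarrow> w \<in> V1 k"
      using p_eq M_eq by (auto simp: V2_def)
  qed
qed

text \<open>Now \<open>a\<close> and \<open>b\<close> see the same labelled points. Equal labels
  make \<open>a\<close> refute \<open>E0\<close>, distinct labels of one colour make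
  \<open>b\<close> refute \<open>E1\<close>, and the variables of \<open>E0\<close> and
  \<open>E1\<close> take the same values on the common part.\<close>

lemma no_factor_Y3:
  assumes E: "Or E0 E1 \<in> Logic r" and card: "card (vars E0 \<union> vars E1) < length zs"
    and a: "(z, a) \<in> r" "r `` {a} = {a, p, p'} \<union> M"
    and b: "(z, b) \<in> r" "r `` {b} = {b, p, p'} \<union> M"
    and ab: "a \<notin> {b, p, p'} \<union> M" "b \<notin> {a, p, p'} \<union> M"
  shows "\<exists>V w. persistent r V \<and> w \<in> Field r \<and>
    (forces r V w (subst \<beta> E0) \<noteq> forces r V w (And (Imp (Var s) E0) (Imp (Neg (Var s))
       (Imp (agree q zs) (Or (Var u) (Imp (Var u) (Var q)))))) \<or>
     forces r V w (subst \<beta> E1) \<noteq> forces r V w (And (Imp (Var s) E1) (Imp (Neg (Var s)) (agree q zs))))"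
proof (rule ccontr)
  let ?P = "agree q zs" and ?K = "vars E0 \<union> vars E1" and ?Q = "Or (Var u) (Imp (Var u) (Var q))"
  assume "\<not> ?thesis"
  then have eq: "forces r V w (subst \<beta> E0) \<longleftrightarrow>
      forces r V w (And (Imp (Var s) E0) (Imp (Neg (Var s)) (Imp ?P ?Q)))"
    "forces r V w (subst \<beta> E1) \<longleftrightarrow> forces r V w (And (Imp (Var s) E1) (Imp (Neg (Var s)) ?P))"
    if "persistent r V" "w \<in> Field r" for V w
    using that by blast+
  have "finite ?K"
    by (simp add: fm.set_finite)
  then obtain I J where IJ: "I \<subseteq> set zs" "J \<subseteq> set zs" "I \<noteq> J"
    and col: "\<And>k B B' I' J'. k \<in> ?K \<Longrightarrow>
      forces r (val I J' B) p (\<beta> k) \<longleftrightarrow> forces r (val I' J B') p' (\<beta> k)"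
    by (rule exists_same_colour[OF _ card, where \<beta> = \<beta>]) (rule that)
  have upa: "(a, v) \<in> r \<longleftrightarrow> v \<in> {a, p, p'} \<union> M" and upb: "(b, v) \<in> r \<longleftrightarrow> v \<in> {b, p, p'} \<union> M" for v
    using a(2) b(2) by auto
  have F: "a \<in> Field r" "b \<in> Field r"
    using a(1) b(1) by (blast intro: FieldI2)+
  define V0 where "V0 = subst_val r (val I I {}) \<beta>"
  define V1 where "V1 = subst_val r (val I J {}) \<beta>"
  have per: "persistent r (val I' J' {})" for I' J'
    by (rule persistent_val) auto
  have s: "forces r (val I' J' B) w (Neg (Var s))" for I' J' B w
    by (simp add: val_def)
  have "\<not> forces r (val I J {}) b ?P"
    using not_agree_val[OF _ _ IJ] upb by blast
  then have "\<not> forces r (val I J {}) b (subst \<beta> E1)"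
    unfolding eq(2)[OF per F(2)] using s frame_refl[OF frame F(2)]
    by (metis forces.simps(3,5))
  then have 1: "\<not> forces r V1 b E1"
    unfolding V1_def by (simp add: forces_subst F)
  have "forces r (val I I {}) a (split q x)" if "x \<in> set zs" for x
    using that distinct ab new by (auto simp: split_def val_def upa up_p up_p' split: if_splits)
  then have "forces r (val I I {}) a ?P"
    by (simp add: forces_agree)
  \<comment> \<open>At \<open>a\<close> the variable \<open>u\<close> fails, while \<open>p\<close>
    above it has \<open>u\<close> without \<open>q\<close>.\<close>
  moreover have "\<not> forces r (val I I {}) a ?Q"
    using distinct ab new upa by (auto simp: val_def)
  ultimately have "\<not> forces r (val I I {}) a (subst \<beta> E0)"
    unfolding eq(1)[OF per F(1)] using s frame_refl[OF frame F(1)]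
    by (metis forces.simps(3,5))
  then have 0: "\<not> forces r V0 a E0"
    unfolding V0_def by (simp add: forces_subst F)
  have V0: "persistent r V0" and V1: "persistent r V1"
    unfolding V0_def V1_def using per by (auto intro: persistent_subst_val frame)
  have p_eq: "p \<in> V0 k \<longleftrightarrow> p \<in> V1 k" for k
    using forces_val_p M_Field by (auto simp: V0_def V1_def subst_val_def)
  have M_eq: "m \<in> V0 k \<longleftrightarrow> m \<in> V1 k" if "m \<in> M" for k m
    using forces_val_M[OF that, of I I "{}" "\<beta> k" I J "{}"] by (auto simp: V0_def V1_def subst_val_def)
  \<comment> \<open>The label of \<open>p'\<close> is \<open>I\<close> for \<open>V0\<close> and
    \<open>J\<close> for \<open>V1\<close>; having the same colour, these force the same
    \<open>\<beta> k\<close>.\<close>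
  have p'_eq: "p' \<in> V0 k \<longleftrightarrow> p' \<in> V1 k" if "k \<in> ?K" for k
    using col[OF that] M_Field forces_val_p'[of I I "{}" "\<beta> k" "{}" "{}"] forces_val_p[of I "{}" "{}" "\<beta> k"]
    by (auto simp: V0_def V1_def subst_val_def)
  show False
  proof (rule glue[OF frame E a(1) 0 V0 b(1) 1 V1])
    fix w k assume "(a, w) \<in> r" "(b, w) \<in> r" and k: "k \<in> ?K"
    then have "w = p \<or> w = p' \<or> w \<in> M"
      using ab by (auto simp: upa upb)
    then show "w \<in> V0 k \<longleftrightarrow> w \<in> V1 k"
      using p_eq p'_eq[OF k] M_eq by blast
  qed
qed

end

section \<open>Choice of variables and the two shapes of frames\<close>

lemma exists_fresh:
  assumes "finite (K :: nat set)"
  obtains s q u zs where "distinct (s # q # u # zs)" "s \<notin> K" "card K < length zs"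
proof -
  \<comment> \<open>The list has \<open>card K + 1\<close> entries and leaves 0 and 1 for
    \<open>q\<close> and \<open>u\<close>; \<open>s\<close> alone is chosen outside
    \<open>K\<close>.\<close>
  define zs where "zs = [2..<3 + card K]"
  obtain s where s: "s \<notin> K \<union> set (0 # 1 # zs)"
    using assms ex_new_if_finite[OF infinite_UNIV_nat] by (metis List.finite_set finite_UnI)
  show thesis
    by (rule that[of s 0 1 zs]) (use s in \<open>auto simp: zs_def\<close>)
qed

text \<open>The conditions \<open>cmp\<close>, \<open>cub\<close> and \<open>mx\<close> make the
  extension a unifier; the equations for up-sets exclude a factorization. With \<open>M\<close>
  empty this covers \<open>Y2\<close>, with \<open>M\<close> consisting of the new top it covers
  \<open>add_top Y2\<close>.\<close>

lemma nullary_Y2_shape: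
  fixes r :: "'w rel"
  assumes fr: "frame r"
    and cmp: "\<And>v w. v \<in> Field r \<Longrightarrow> w \<in> Field r \<Longrightarrow> \<not> linear_above r v \<Longrightarrow> \<not> linear_above r w \<Longrightarrow>
      (v, w) \<in> r \<or> (w, v) \<in> r"
    and cub: "\<And>v w. v \<in> Field r \<Longrightarrow> w \<in> Field r \<Longrightarrow> \<not> linear_above r v \<Longrightarrow> \<exists>e. (v, e) \<in> r \<and> (w, e) \<in> r"
    and mx: "\<And>w. w \<in> Field r \<Longrightarrow> \<exists>v. (w, v) \<in> r \<and> maximal_in r v"
    and p: "r `` {p} = insert p M" "r `` {p'} = insert p' M" "p \<notin> M" "p' \<notin> M" "p \<noteq> p'"
    and ab: "(z, a) \<in> r" "r `` {a} = {a, p} \<union> M" "(z, b) \<in> r" "r `` {b} = {b, p, p'} \<union> M"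
      "a \<notin> {b, p, p'} \<union> M" "b \<notin> {a, p, p'} \<union> M"
  shows "nullary_unification (Logic r)"
proof (rule nullary_witness[OF fr])
  fix E0 E1 assume E: "Or E0 E1 \<in> Logic r"
  obtain s q u zs where d: "distinct (s # q # u # zs)" and s: "s \<notin> vars E0 \<union> vars E1"
    and card: "card (vars E0 \<union> vars E1) < length zs"
    by (rule exists_fresh[of "vars E0 \<union> vars E1"]) (simp_all add: fm.set_finite)
  interpret clique r M p p' s q u zs
    using fr p d by unfold_locales
  show "\<exists>s G H. s \<notin> vars E0 \<union> vars E1 \<and>
      (\<forall>\<epsilon>. unifier (Logic r) witness \<epsilon> \<longrightarrow> unifier (Logic r) witness (extend s G H \<epsilon>)) \<and>
      (\<forall>\<beta>. \<exists>V w. persistent r V \<and> w \<in> Field r \<and>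
         (forces r V w (subst \<beta> E0) \<noteq> forces r V w (And (Imp (Var s) E0) (Imp (Neg (Var s)) G)) \<or>
          forces r V w (subst \<beta> E1) \<noteq> forces r V w (And (Imp (Var s) E1) (Imp (Neg (Var s)) H))))"
    using s unifier_extend_Y2[OF fr _ cmp cub mx] no_factor_Y2[OF E card ab] by blast
qed

lemma nullary_Y3_shape:
  fixes r :: "'w rel"
  assumes fr: "frame r"
    and cmp: "\<And>v w e e'. (v, w) \<in> r \<Longrightarrow> v \<noteq> w \<Longrightarrow> e \<in> Field r \<Longrightarrow> e' \<in> Field r \<Longrightarrow>
      (e, e') \<notin> r \<Longrightarrow> (e', e) \<notin> r \<Longrightarrow> (v, e) \<in> r \<and> (v, e') \<in> r \<or> (e, w) \<in> r \<and> (e', w) \<in> r"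
    and cub: "\<And>v w. v \<in> Field r \<Longrightarrow> w \<in> Field r \<Longrightarrow> \<not> maximal_in r v \<Longrightarrow> \<exists>e. (v, e) \<in> r \<and> (w, e) \<in> r"
    and mx: "\<And>w. w \<in> Field r \<Longrightarrow> \<exists>v. (w, v) \<in> r \<and> maximal_in r v"
    and p: "r `` {p} = insert p M" "r `` {p'} = insert p' M" "p \<notin> M" "p' \<notin> M" "p \<noteq> p'"
    and ab: "(z, a) \<in> r" "r `` {a} = {a, p, p'} \<union> M" "(z, b) \<in> r" "r `` {b} = {b, p, p'} \<union> M"
      "a \<notin> {b, p, p'} \<union> M" "b \<notin> {a, p, p'} \<union> M"
  shows "nullary_unification (Logic r)"
proof (rule nullary_witness[OF fr])
  fix E0 E1 assume E: "Or E0 E1 \<in> Logic r"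
  obtain s q u zs where d: "distinct (s # q # u # zs)" and s: "s \<notin> vars E0 \<union> vars E1"
    and card: "card (vars E0 \<union> vars E1) < length zs"
    by (rule exists_fresh[of "vars E0 \<union> vars E1"]) (simp_all add: fm.set_finite)
  interpret clique r M p p' s q u zs
    using fr p d by unfold_locales
  show "\<exists>s G H. s \<notin> vars E0 \<union> vars E1 \<and>
      (\<forall>\<epsilon>. unifier (Logic r) witness \<epsilon> \<longrightarrow> unifier (Logic r) witness (extend s G H \<epsilon>)) \<and>
      (\<forall>\<beta>. \<exists>V w. persistent r V \<and> w \<in> Field r \<and>
         (forces r V w (subst \<beta> E0) \<noteq> forces r V w (And (Imp (Var s) E0) (Imp (Neg (Var s)) G)) \<or>
          forces r V w (subst \<beta> E1) \<noteq> forces r V w (And (Imp (Var s) E1) (Imp (Neg (Var s)) H))))"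
    using s unifier_extend_Y3[OF fr _ cmp cub mx] no_factor_Y3[OF E card ab] by blast
qed

section \<open>Verification for the four frames\<close>

lemma all_y2: "(\<forall>x. P x) \<longleftrightarrow> P R2 \<and> P A2 \<and> P B2 \<and> P T2 \<and> P S2"
  by (metis y2.exhaust)

lemma all_y3: "(\<forall>x. P x) \<longleftrightarrow> P R3 \<and> P A3 \<and> P B3 \<and> P C3 \<and> P D3"
  by (metis y3.exhaust)

lemma ex_y2: "(\<exists>x. P x) \<longleftrightarrow> P R2 \<or> P A2 \<or> P B2 \<or> P T2 \<or> P S2"
  by (metis y2.exhaust)

lemma ex_y3: "(\<exists>x. P x) \<longleftrightarrow> P R3 \<or> P A3 \<or> P B3 \<or> P C3 \<or> P D3"
  by (metis y3.exhaust)

lemma add_top_iff [simp]: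
  "(Some x, Some y) \<in> add_top r \<longleftrightarrow> (x, y) \<in> r"
  "(None, Some y) \<notin> add_top r"
  "(u, None) \<in> add_top r \<longleftrightarrow> u \<in> insert None (Some ` Field r)"
  by (auto simp: add_top_def)

text \<open>Quantifiers over the finite carriers become finite conjunctions and disjunctions, which
  decides the order conditions by simplification.\<close>

lemmas Y2_simps = all_y2 ex_y2 split_option_all split_option_ex Y2_iff Field_Y2 linear_above_def maximal_in_def
lemmas Y3_simps = all_y3 ex_y3 split_option_all split_option_ex Y3_iff Field_Y3 linear_above_def maximal_in_def

lemma nullary_Y2: "nullary_unification (Logic Y2)"
proof (rule nullary_Y2_shape[OF frame_Y2])
  \<comment> \<open>Only \<open>R2\<close> and \<open>B2\<close> have a branching up-set.\<close>
  have "\<forall>v w. \<not> linear_above Y2 v \<longrightarrow> \<not> linear_above Y2 w \<longrightarrow> (v, w) \<in> Y2 \<or> (w, v) \<in> Y2"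
    by (simp add: Y2_simps)
  then show "(v, w) \<in> Y2 \<or> (w, v) \<in> Y2" if "\<not> linear_above Y2 v" "\<not> linear_above Y2 w" for v w
    using that by blast
  have "\<forall>v w. \<not> linear_above Y2 v \<longrightarrow> (\<exists>e. (v, e) \<in> Y2 \<and> (w, e) \<in> Y2)"
    by (simp add: Y2_simps)
  then show "\<exists>e. (v, e) \<in> Y2 \<and> (w, e) \<in> Y2" if "\<not> linear_above Y2 v" for v w
    using that by blast
  have "\<forall>w. \<exists>v. (w, v) \<in> Y2 \<and> maximal_in Y2 v"
    by (simp add: Y2_simps)
  then show "\<exists>v. (w, v) \<in> Y2 \<and> maximal_in Y2 v" for w
    by blast
  \<comment> \<open>These equations fix the roles: \<open>T2\<close> and \<open>S2\<close> are the
    labelled points, \<open>A2\<close> sees only the first of them and \<open>B2\<close> sees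
    both.\<close>
  show "Y2 `` {T2} = insert T2 {}" "Y2 `` {S2} = insert S2 {}"
    "Y2 `` {A2} = {A2, T2} \<union> {}" "Y2 `` {B2} = {B2, T2, S2} \<union> {}"
    by (auto simp: Y2_iff)
  show "(R2, A2) \<in> Y2" "(R2, B2) \<in> Y2"
    by (simp_all add: Y2_iff)
qed auto

lemma nullary_Y2_top: "nullary_unification (Logic (add_top Y2))"
proof (rule nullary_Y2_shape[OF frame_add_top[OF frame_Y2]])
  let ?r = "add_top Y2"
  have "\<forall>v w. \<not> linear_above ?r v \<longrightarrow> \<not> linear_above ?r w \<longrightarrow> (v, w) \<in> ?r \<or> (w, v) \<in> ?r"
    by (simp add: Y2_simps)
  then show "(v, w) \<in> ?r \<or> (w, v) \<in> ?r" if "\<not> linear_above ?r v" "\<not> linear_above ?r w" for v w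
    using that by blast
  have top: "(w, None) \<in> ?r" for w
    by (cases w) (simp_all add: Field_Y2)
  then show "\<exists>e. (v, e) \<in> ?r \<and> (w, e) \<in> ?r" for v w
    by blast
  have "maximal_in ?r None"
    by (simp add: Y2_simps)
  then show "\<exists>v. (w, v) \<in> ?r \<and> maximal_in ?r v" for w
    using top by blast
  show "?r `` {Some T2} = insert (Some T2) {None}" "?r `` {Some S2} = insert (Some S2) {None}"
    "?r `` {Some A2} = {Some A2, Some T2} \<union> {None}"
    "?r `` {Some B2} = {Some B2, Some T2, Some S2} \<union> {None}"
    by (auto simp: add_top_def Y2_iff Field_Y2)
  show "(Some R2, Some A2) \<in> ?r" "(Some R2, Some B2) \<in> ?r"
    by (simp_all add: Y2_iff)
qed auto

lemma nullary_Y3: "nullary_unification (Logic Y3)"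
proof (rule nullary_Y3_shape[OF frame_Y3])
  \<comment> \<open>The incomparable pairs are \<open>A3\<close>, \<open>B3\<close> and
    \<open>C3\<close>, \<open>D3\<close>. A strict step starts at \<open>R3\<close>, which sees all
    four, or leads from \<open>A3\<close> or \<open>B3\<close>, which see \<open>C3\<close> and
    \<open>D3\<close>, to a point above both \<open>A3\<close> and \<open>B3\<close>.\<close>
  have "\<forall>v w e e'. (v, w) \<in> Y3 \<longrightarrow> v \<noteq> w \<longrightarrow> (e, e') \<notin> Y3 \<longrightarrow> (e', e) \<notin> Y3 \<longrightarrow>
      (v, e) \<in> Y3 \<and> (v, e') \<in> Y3 \<or> (e, w) \<in> Y3 \<and> (e', w) \<in> Y3"
    by (simp add: Y3_simps)
  then show "(v, e) \<in> Y3 \<and> (v, e') \<in> Y3 \<or> (e, w) \<in> Y3 \<and> (e', w) \<in> Y3"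
    if "(v, w) \<in> Y3" "v \<noteq> w" "(e, e') \<notin> Y3" "(e', e) \<notin> Y3" for v w e e'
    using that by blast
  have "\<forall>v w. \<not> maximal_in Y3 v \<longrightarrow> (\<exists>e. (v, e) \<in> Y3 \<and> (w, e) \<in> Y3)"
    by (simp add: Y3_simps)
  then show "\<exists>e. (v, e) \<in> Y3 \<and> (w, e) \<in> Y3" if "\<not> maximal_in Y3 v" for v w
    using that by blast
  have "\<forall>w. \<exists>v. (w, v) \<in> Y3 \<and> maximal_in Y3 v"
    by (simp add: Y3_simps)
  then show "\<exists>v. (w, v) \<in> Y3 \<and> maximal_in Y3 v" for w
    by blast
  show "Y3 `` {C3} = insert C3 {}" "Y3 `` {D3} = insert D3 {}"
    "Y3 `` {A3} = {A3, C3, D3} \<union> {}" "Y3 `` {B3} = {B3, C3, D3} \<union> {}"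
    by (auto simp: Y3_iff)
  show "(R3, A3) \<in> Y3" "(R3, B3) \<in> Y3"
    by (simp_all add: Y3_iff)
qed auto

lemma nullary_Y3_top: "nullary_unification (Logic (add_top Y3))"
proof (rule nullary_Y3_shape[OF frame_add_top[OF frame_Y3]])
  let ?r = "add_top Y3"
  \<comment> \<open>The additional strict steps lead to \<open>None\<close>, which is above every
    pair.\<close>
  have "\<forall>v w e e'. (v, w) \<in> ?r \<longrightarrow> v \<noteq> w \<longrightarrow> (e, e') \<notin> ?r \<longrightarrow> (e', e) \<notin> ?r \<longrightarrow>
      (v, e) \<in> ?r \<and> (v, e') \<in> ?r \<or> (e, w) \<in> ?r \<and> (e', w) \<in> ?r"
    by (simp add: Y3_simps)
  then show "(v, e) \<in> ?r \<and> (v, e') \<in> ?r \<or> (e, w) \<in> ?r \<and> (e', w) \<in> ?r"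
    if "(v, w) \<in> ?r" "v \<noteq> w" "(e, e') \<notin> ?r" "(e', e) \<notin> ?r" for v w e e'
    using that by blast
  have top: "(w, None) \<in> ?r" for w
    by (cases w) (simp_all add: Field_Y3)
  then show "\<exists>e. (v, e) \<in> ?r \<and> (w, e) \<in> ?r" for v w
    by blast
  have "maximal_in ?r None"
    by (simp add: Y3_simps)
  then show "\<exists>v. (w, v) \<in> ?r \<and> maximal_in ?r v" for w
    using top by blast
  show "?r `` {Some C3} = insert (Some C3) {None}" "?r `` {Some D3} = insert (Some D3) {None}"
    "?r `` {Some A3} = {Some A3, Some C3, Some D3} \<union> {None}"
    "?r `` {Some B3} = {Some B3, Some C3, Some D3} \<union> {None}"
    by (auto simp: add_top_def Y3_iff Field_Y3)
  show "(Some R3, Some A3) \<in> ?r" "(Some R3, Some B3) \<in> ?r"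
    by (simp_all add: Y3_iff)
qed auto

theorem theorem5p12:
  shows "nullary_unification (Logic Y2)
    \<and> nullary_unification (Logic (add_top Y2))
    \<and> nullary_unification (Logic Y3)
    \<and> nullary_unification (Logic (add_top Y3))"
  by (intro conjI nullary_Y2 nullary_Y2_top nullary_Y3 nullary_Y3_top)

end
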